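(* Let $X \in 2^\omega$. The following are equivalent: (i) $X$ is not computably random. (ii) There exists a winning open set $\mathcal{U}\subseteq 2^\omega$ such that all tails of $X$ belong to $\mathcal{U}$. (iii) $X \in U^\omega$ for some winning subset $U$ of $2^{<\omega}$.
   Context: $2^\omega$ is Cantor space, $2^{<\omega}$ the set of finite binary strings, $\epsilon$ the empty string. For a string $\sigma$, $[\sigma]$ is the set of infinite sequences with prefix $\sigma$; for $U \subseteq 2^{<\omega}$, $[U]=\bigcup_{\sigma\in U}[\sigma]$. A tail of $X$ is any sequence $X(k)X(k+1)X(k+2)\ldots$ with $k \in \mathbb{N}$. For $S\subseteq 2^{<\omega}$, $S^\omega$ is the set of $A\in 2^\omega$ of the form $A=\sigma_0\sigma_1\sigma_2\ldots$ with all $\sigma_i \in S$. A martingale is a function $d:2^{<\omega}\to\mathbb{R}^{\geq 0}$ with $d(\sigma)=\frac{d(\sigma 0)+d(\sigma 1)}{2}$ for all $\sigma$; it is normed if $d(\epsilon)=1$; it succeeds on $X$ if $\limsup_n d(X\upharpoonright n)=+\infty$, where $X\upharpoonright n$ is the prefix of $X$ of length $n$. $X$ is computably random if no computable martingale (computable as a real-valued function) succeeds on $X$. An exactly computable martingale is a rational-valued martingale that is computable as a function into $\mathbb{Q}^{\geq 0}$. A string is minimal for a property if it satisfies the property and no proper prefix of it does. A set $U\subseteq 2^{<\omega}$ is a winning set if there are an exactly computable normed martingale $d$ and a rational $q>1$ with $U=\{\sigma : \sigma \text{ minimal such that } d(\sigma)\geq q\}$. A winning open set is a set of the form $[U]$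 with $U$ a winning set of strings. *)

theory Defs
  imports Complex_Main "HOL-Library.Extended_Real" "HOL-Library.Liminf_Limsup" "HOL-Library.Sublist"
begin

type_synonym string2 = "bool list"
type_synonym cantor = "nat \<Rightarrow> bool"

text \<open>
  The total recursive functions of arity \<open>k\<close>, generated with minimization of regular functions
  only.  A function of arity \<open>k\<close> is represented by a function on lists; its values on lists of
  length different from \<open>k\<close> are irrelevant.
\<close>

inductive recursive_fn :: "nat \<Rightarrow> (nat list \<Rightarrow> nat) \<Rightarrow> bool" where
  zero: "recursive_fn k (\<lambda>xs. 0)"
| succ: "recursive_fn 1 (\<lambda>xs. Suc (xs ! 0))"
| proj: "i < k \<Longrightarrow> recursive_fn k (\<lambda>xs. xs ! i)"
| comp: "recursive_fn (length gs) f \<Longrightarrow> (\<forall>g\<in>set gs. recursive_fn k g)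
    \<Longrightarrow> recursive_fn k (\<lambda>xs. f (map (\<lambda>g. g xs) gs))"
| prim_rec: "recursive_fn k f \<Longrightarrow> recursive_fn (Suc (Suc k)) h
    \<Longrightarrow> recursive_fn (Suc k)
          (\<lambda>xs. rec_nat (f (tl xs)) (\<lambda>y r. h (y # r # tl xs)) (hd xs))"
| mu: "recursive_fn (Suc k) f \<Longrightarrow> (\<forall>xs. length xs = k \<longrightarrow> (\<exists>y. f (y # xs) = 0))
    \<Longrightarrow> recursive_fn k (\<lambda>xs. LEAST y. f (y # xs) = 0)"

text \<open>Rationals are presented as \<open>(a - b) / c\<close> with natural numbers \<open>a\<close>, \<open>b\<close> and \<open>c \<noteq> 0\<close>.\<close>

definition recursive_rat_fn :: "nat \<Rightarrow> (nat list \<Rightarrow> rat) \<Rightarrow> bool" where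
  "recursive_rat_fn k f \<longleftrightarrow>
     (\<exists>a b c. recursive_fn k a \<and> recursive_fn k b \<and> recursive_fn k c \<and>
        (\<forall>xs. length xs = k \<longrightarrow>
           c xs \<noteq> 0 \<and> f xs = (of_nat (a xs) - of_nat (b xs)) / of_nat (c xs)))"

text \<open>
  The position of a string in the length-lexicographic order (with \<open>False < True\<close>); this is the
  usual computable bijection between finite binary strings and natural numbers.
\<close>

definition string_code :: "string2 \<Rightarrow> nat" where
  "string_code \<sigma> = foldl (\<lambda>n b. 2 * n + (if b then 2 else 1)) 0 \<sigma>"

definition computable_real_valued :: "(string2 \<Rightarrow> real) \<Rightarrow> bool" where
  "computable_real_valued d \<longleftrightarrow>
     (\<exists>f. recursive_rat_fn 2 f \<and>
        (\<forall>\<sigma> n. \<bar>d \<sigma> - of_rat (f [string_code \<sigma>, n])\<bar> \<le> 1 / 2 ^ n))"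

definition exactly_computable :: "(string2 \<Rightarrow> real) \<Rightarrow> bool" where
  "exactly_computable d \<longleftrightarrow>
     (\<exists>f. recursive_rat_fn 1 f \<and> (\<forall>\<sigma>. d \<sigma> = of_rat (f [string_code \<sigma>])))"

definition initial_segment :: "cantor \<Rightarrow> nat \<Rightarrow> string2" where
  "initial_segment X n = map X [0..<n]"

definition cylinder :: "string2 \<Rightarrow> cantor set" where
  "cylinder \<sigma> = {X. initial_segment X (length \<sigma>) = \<sigma>}"

definition open_of :: "string2 set \<Rightarrow> cantor set" where
  "open_of U = (\<Union>\<sigma>\<in>U. cylinder \<sigma>)"

definition tail :: "nat \<Rightarrow> cantor \<Rightarrow> cantor" where
  "tail k X = (\<lambda>n. X (k + n))"

text \<open>
  \<open>A = \<sigma>\<^sub>0\<sigma>\<^sub>1\<sigma>\<^sub>2\<dots>\<close> means that every finite concatenation is a prefix of \<open>A\<close> and that these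
  concatenations exhaust \<open>A\<close>.  The second part matters only if almost all \<open>\<sigma>\<^sub>i\<close> are empty, in
  which case the concatenation is a finite string and not an element of Cantor space.
\<close>

definition is_infinite_concat :: "(nat \<Rightarrow> string2) \<Rightarrow> cantor \<Rightarrow> bool" where
  "is_infinite_concat s A \<longleftrightarrow>
     (\<forall>n. A \<in> cylinder (concat (map s [0..<n]))) \<and>
     (\<forall>m. \<exists>n. m \<le> length (concat (map s [0..<n])))"

definition omega_power :: "string2 set \<Rightarrow> cantor set" where
  "omega_power S = {A. \<exists>s. (\<forall>i. s i \<in> S) \<and> is_infinite_concat s A}"

definition martingale :: "(string2 \<Rightarrow> real) \<Rightarrow> bool" where
  "martingale d \<longleftrightarrow>
     (\<forall>\<sigma>. 0 \<le> d \<sigma>) \<and> (\<forall>\<sigma>. d \<sigma> = (d (\<sigma> @ [False]) + d (\<sigma> @ [True])) / 2)"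

definition normed :: "(string2 \<Rightarrow> real) \<Rightarrow> bool" where
  "normed d \<longleftrightarrow> d [] = 1"

definition succeeds_on :: "(string2 \<Rightarrow> real) \<Rightarrow> cantor \<Rightarrow> bool" where
  "succeeds_on d X \<longleftrightarrow> limsup (\<lambda>n. ereal (d (initial_segment X n))) = \<infinity>"

definition computably_random :: "cantor \<Rightarrow> bool" where
  "computably_random X \<longleftrightarrow>
     \<not> (\<exists>d. martingale d \<and> computable_real_valued d \<and> succeeds_on d X)"

definition minimal_strings :: "(string2 \<Rightarrow> bool) \<Rightarrow> string2 set" where
  "minimal_strings P = {\<sigma>. P \<sigma> \<and> (\<forall>\<tau>. strict_prefix \<tau> \<sigma> \<longrightarrow> \<not> P \<tau>)}"

definition winning_set :: "string2 set \<Rightarrow> bool" where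
  "winning_set U \<longleftrightarrow>
     (\<exists>d (q :: rat). martingale d \<and> exactly_computable d \<and> normed d \<and> q > 1 \<and>
        U = minimal_strings (\<lambda>\<sigma>. d \<sigma> \<ge> of_rat q))"

definition winning_open_set :: "cantor set \<Rightarrow> bool" where
  "winning_open_set \<U> \<longleftrightarrow> (\<exists>U. winning_set U \<and> \<U> = open_of U)"

end

theory Submission imports Defs
begin

text \<open>
  The three conditions are linked in a cycle.

  If \<open>X\<close> is not computably random, some computable real-valued martingale succeeds on it, and this
  martingale can be replaced by a rational-valued, exactly computable, normed one
  (\<open>rational_martingale\<close>): one keeps the idea of the bets but rounds each of them to a rational,
  with errors that shrink so fast along a string that their sum stays bounded.  If the rational
  martingale \<open>d\<close> succeeds on \<open>X = \<sigma>Y\<close>, then the bets of \<open>d\<close> on \<open>\<sigma>Y\<close>, seen as bets on \<open>Y\<close>, win an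
  unbounded amount on the tail \<open>Y\<close>.  A gambler who does not know \<open>\<sigma>\<close> plays against
  all strings \<open>\<sigma>\<close> at once, with a small share of the capital for each.  To keep the capital a finite
  sum of rationals, the \<open>n\<close>-th string enters the game only after \<open>n\<close> bits
  (\<open>bet_on_all_tails\<close>).  The resulting martingale is unbounded on every tail of \<open>X\<close>, hence reaches
  2 on every tail, and this gives the winning open set (\<open>winning_cover_of_tails\<close>).

  If all tails of \<open>X\<close> lie in \<open>[U]\<close>, then one cuts from \<open>X\<close> a prefix in \<open>U\<close>, then from the
  remaining tail another one, and so on (\<open>omega_power_of_cover\<close>).

  If \<open>X\<close> is a concatenation of strings at which a normed martingale \<open>d\<close> reaches \<open>q > 1\<close> for the first
  time, then one plays \<open>d\<close>, and each time it reaches \<open>q\<close> one restarts it with the whole capital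
  won so far (\<open>replay\<close>).  The blocks are found by a greedy parse, because minimal strings form an
  antichain.  After \<open>n\<close> blocks the capital is at least \<open>q ^ n\<close>
  (\<open>not_random_of_omega_power\<close>).

  What remains is to see that the constructed martingales are exactly computable.  Their values are
  finite sums and products of values of the given martingale, or of its rational approximations, at
  strings obtained by concatenation and truncation, so closure properties of the recursive functions suffice; the only recursion that
  is needed is the one that finds the current block of the parse.
\<close>

section \<open>Closure properties of recursive functions on natural numbers\<close>

text \<open>
  \<open>recursive_fn k f\<close> fixes the values of \<open>f\<close> also on lists whose length is not \<open>k\<close>.  Only the values
  on lists of length \<open>k\<close> have a meaning, and closure properties become usable as introduction rules
  once the others are disregarded.  In these rules the list of arguments is read with \<open>hd\<close> and \<open>tl\<close>, so that
  a bound variable of a sum, product or recursion is an argument prepended to the list.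
\<close>

definition computable :: "nat \<Rightarrow> (nat list \<Rightarrow> nat) \<Rightarrow> bool" where
  "computable k f \<longleftrightarrow> (\<exists>g. recursive_fn k g \<and> (\<forall>xs. length xs = k \<longrightarrow> f xs = g xs))"

named_theorems computable_intros

lemma computable_cong:
  assumes "computable k g" "\<And>xs. length xs = k \<Longrightarrow> f xs = g xs"
  shows "computable k f"
  using assms unfolding computable_def by auto

lemma computable_comp:
  assumes f: "computable (length gs) f" and gs: "\<And>g. g \<in> set gs \<Longrightarrow> computable k g"
  shows "computable k (\<lambda>xs. f (map (\<lambda>g. g xs) gs))"
proof -
  obtain f' where f': "recursive_fn (length gs) f'"
      "\<And>xs. length xs = length gs \<Longrightarrow> f xs = f' xs"
    using f unfolding computable_def by auto
  have "\<forall>g\<in>set gs. \<exists>h. recursive_fn k h \<and> (\<forall>xs. length xs = k \<longrightarrow> g xs = h xs)"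
    using gs unfolding computable_def by auto
  then obtain H where H: "\<And>g. g \<in> set gs \<Longrightarrow> recursive_fn k (H g)"
      "\<And>g xs. g \<in> set gs \<Longrightarrow> length xs = k \<Longrightarrow> g xs = H g xs"
    by metis
  have "recursive_fn k (\<lambda>xs. f' (map (\<lambda>g. g xs) (map H gs)))"
    by (rule recursive_fn.comp) (use f' H in auto)
  moreover have "f (map (\<lambda>g. g xs) gs) = f' (map (\<lambda>g. g xs) (map H gs))" if "length xs = k" for xs
  proof -
    have "map (\<lambda>g. g xs) gs = map (\<lambda>g. g xs) (map H gs)"
      using H(2) that by (simp add: comp_def)
    then show ?thesis by (metis length_map f'(2))
  qed
  ultimately show ?thesis unfolding computable_def by blast
qed

lemma computable_nth: "i < k \<Longrightarrow> computable k (\<lambda>xs. xs ! i)"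
  unfolding computable_def using recursive_fn.proj by blast

lemma computable_hd [computable_intros]: "0 < k \<Longrightarrow> computable k hd"
  by (rule computable_cong[OF computable_nth[of 0]]) (auto simp: hd_conv_nth)

lemma computable_tl:
  assumes "computable k f"
  shows "computable (Suc k) (\<lambda>xs. f (tl xs))"
proof -
  have "computable (Suc k) (\<lambda>xs. f (map (\<lambda>g. g xs) (map (\<lambda>i xs. xs ! Suc i) [0..<k])))"
    by (rule computable_comp) (use assms in \<open>auto intro: computable_nth\<close>)
  then show ?thesis
  proof (rule computable_cong)
    fix xs :: "nat list" assume "length xs = Suc k"
    then have "map (\<lambda>i. xs ! Suc i) [0..<k] = tl xs"
      by (intro nth_equalityI) (auto simp: nth_tl)
    then show "f (tl xs) = f (map (\<lambda>g. g xs) (map (\<lambda>i xs. xs ! Suc i) [0..<k]))"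
      by (simp add: comp_def)
  qed
qed

lemma computable_hd_tl [computable_intros]:
  assumes "1 < k" shows "computable k (\<lambda>xs. hd (tl xs))"
  using computable_tl[OF computable_hd[of "k - 1"]] assms by simp

lemma computable_comp1:
  assumes "computable 1 (\<lambda>xs. F (hd xs))" "computable k f"
  shows "computable k (\<lambda>xs. F (f xs))"
  using computable_comp[of "[f]" "\<lambda>xs. F (hd xs)" k] assms by auto

lemma computable_Suc [computable_intros]:
  assumes "computable k f" shows "computable k (\<lambda>xs. Suc (f xs))"
proof (rule computable_comp1[OF _ assms])
  show "computable 1 (\<lambda>xs. Suc (hd xs))"
    using recursive_fn.succ unfolding computable_def
    by (intro exI[of _ "\<lambda>xs. Suc (xs ! 0)"] conjI) (auto simp: length_Suc_conv)
qed

lemma computable_const [computable_intros]: "computable k (\<lambda>xs. c)"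
proof (induction c)
  case 0
  then show ?case unfolding computable_def using recursive_fn.zero by blast
next
  case (Suc c)
  then show ?case by (rule computable_Suc)
qed

lemma computable_rec_nat [computable_intros]:
  assumes n: "computable k n" and f: "computable k f"
    and h: "computable (Suc (Suc k)) (\<lambda>ys. h (hd ys) (hd (tl ys)) (tl (tl ys)))"
  shows "computable k (\<lambda>xs. rec_nat (f xs) (\<lambda>y r. h y r xs) (n xs))"
proof -
  obtain f' where f': "recursive_fn k f'" "\<And>xs. length xs = k \<Longrightarrow> f xs = f' xs"
    using f unfolding computable_def by auto
  obtain h' where h': "recursive_fn (Suc (Suc k)) h'"
    "\<And>xs. length xs = Suc (Suc k) \<Longrightarrow> h (hd xs) (hd (tl xs)) (tl (tl xs)) = h' xs"
    using h unfolding computable_def by auto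
  have "computable (Suc k) (\<lambda>xs. rec_nat (f' (tl xs)) (\<lambda>y r. h' (y # r # tl xs)) (hd xs))"
    unfolding computable_def using recursive_fn.prim_rec[OF f'(1) h'(1)] by blast
  then have "computable k (\<lambda>xs. (\<lambda>xs. rec_nat (f' (tl xs)) (\<lambda>y r. h' (y # r # tl xs)) (hd xs))
       (map (\<lambda>g. g xs) (n # map (\<lambda>i xs. xs ! i) [0..<k])))"
    by (intro computable_comp) (use n in \<open>auto intro: computable_nth\<close>)
  then show ?thesis
  proof (rule computable_cong)
    fix xs :: "nat list" assume xs: "length xs = k"
    have "map (\<lambda>g. g xs) (map (\<lambda>i xs. xs ! i) [0..<k]) = xs"
      using xs by (auto simp: comp_def map_nth)
    moreover have "rec_nat (f xs) (\<lambda>y r. h y r xs) m = rec_nat (f' xs) (\<lambda>y r. h' (y # r # xs)) m" for m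
      using f'(2)[OF xs] h'(2)[of "_ # _ # xs"] xs by (induction m) auto
    ultimately show "rec_nat (f xs) (\<lambda>y r. h y r xs) (n xs) =
       (\<lambda>xs. rec_nat (f' (tl xs)) (\<lambda>y r. h' (y # r # tl xs)) (hd xs))
         (map (\<lambda>g. g xs) (n # map (\<lambda>i xs. xs ! i) [0..<k]))"
      by simp
  qed
qed

lemma computable_add [computable_intros]:
  assumes "computable k f" "computable k g"
  shows "computable k (\<lambda>xs. f xs + g xs)"
proof -
  have eq: "m + n = rec_nat m (\<lambda>y r. Suc r) n" for m n :: nat by (induction n) auto
  show ?thesis unfolding eq by (intro computable_intros computable_tl assms) auto
qed

lemma computable_mult [computable_intros]:
  assumes "computable k f" "computable k g"
  shows "computable k (\<lambda>xs. f xs * g xs)"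
proof -
  have eq: "m * n = rec_nat 0 (\<lambda>y r. r + m) n" for m n :: nat by (induction n) auto
  show ?thesis unfolding eq by (intro computable_intros computable_tl assms) auto
qed

lemma computable_power [computable_intros]:
  assumes "computable k f" "computable k g"
  shows "computable k (\<lambda>xs. f xs ^ g xs)"
proof -
  have eq: "m ^ n = rec_nat 1 (\<lambda>y r. r * m) n" for m n :: nat by (induction n) auto
  show ?thesis unfolding eq by (intro computable_intros computable_tl assms) auto
qed

lemma computable_diff [computable_intros]:
  assumes "computable k f" "computable k g"
  shows "computable k (\<lambda>xs. f xs - g xs)"
proof -
  have pred: "m - 1 = rec_nat 0 (\<lambda>y r. y) m" for m :: nat by (cases m) auto
  have eq: "m - n = rec_nat m (\<lambda>y r. rec_nat 0 (\<lambda>y r. y) r) n" for m n :: nat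
    by (induction n) (auto simp: pred[symmetric])
  show ?thesis unfolding eq by (intro computable_intros computable_tl assms) auto
qed

text \<open>
  In a recursion that computes a sum or product, the step function receives the counter and the accumulated
  value; the summand depends on the counter only.
\<close>

lemma computable_skip_second:
  assumes "computable (Suc k) (\<lambda>ys. f (hd ys) (tl ys))"
  shows "computable (Suc (Suc k)) (\<lambda>ys. f (hd ys) (tl (tl ys)))"
proof -
  let ?gs = "hd # map (\<lambda>i ys. ys ! Suc (Suc i)) [0..<k] :: (nat list \<Rightarrow> nat) list"
  have "computable (Suc (Suc k)) (\<lambda>ys. (\<lambda>zs. f (hd zs) (tl zs)) (map (\<lambda>g. g ys) ?gs))"
    by (rule computable_comp) (use assms in \<open>auto intro: computable_nth computable_hd\<close>)
  then show ?thesis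
  proof (rule computable_cong)
    fix ys :: "nat list" assume "length ys = Suc (Suc k)"
    then have "map (\<lambda>i. ys ! Suc (Suc i)) [0..<k] = tl (tl ys)"
      by (intro nth_equalityI) (auto simp: nth_tl)
    then show "f (hd ys) (tl (tl ys)) = (\<lambda>zs. f (hd zs) (tl zs)) (map (\<lambda>g. g ys) ?gs)"
      by (simp add: comp_def)
  qed
qed

lemma computable_sum [computable_intros]:
  assumes "computable k n" "computable (Suc k) (\<lambda>ys. f (hd ys) (tl ys))"
  shows "computable k (\<lambda>xs. \<Sum>i<n xs. f i xs)"
proof -
  have eq: "(\<Sum>i<n. f i xs) = rec_nat 0 (\<lambda>y r. r + f y xs) n" for n xs by (induction n) auto
  show ?thesis unfolding eq
    by (intro computable_intros computable_skip_second computable_tl assms) auto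
qed

lemma computable_prod [computable_intros]:
  assumes "computable k n" "computable (Suc k) (\<lambda>ys. f (hd ys) (tl ys))"
  shows "computable k (\<lambda>xs. \<Prod>i<n xs. f i xs)"
proof -
  have eq: "(\<Prod>i<n. f i xs) = rec_nat 1 (\<lambda>y r. r * f y xs) n" for n xs by (induction n) auto
  show ?thesis unfolding eq
    by (intro computable_intros computable_skip_second computable_tl assms) auto
qed

definition decidable :: "nat \<Rightarrow> (nat list \<Rightarrow> bool) \<Rightarrow> bool" where
  "decidable k P \<longleftrightarrow> computable k (\<lambda>xs. of_bool (P xs))"

lemma decidable_le [computable_intros]:
  assumes "computable k f" "computable k g"
  shows "decidable k (\<lambda>xs. f xs \<le> g xs)"
proof -
  have eq: "of_bool (m \<le> n) = 1 - (m - n)" for m n :: nat by auto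
  show ?thesis unfolding decidable_def eq by (intro computable_intros assms)
qed

lemma decidable_eq [computable_intros]:
  assumes "computable k f" "computable k g"
  shows "decidable k (\<lambda>xs. f xs = g xs)"
proof -
  have eq: "of_bool (m = n) = 1 - ((m - n) + (n - m))" for m n :: nat by auto
  show ?thesis unfolding decidable_def eq by (intro computable_intros assms)
qed

lemma computable_if [computable_intros]:
  assumes "decidable k P" "computable k f" "computable k g"
  shows "computable k (\<lambda>xs. if P xs then f xs else g xs)"
proof -
  have eq: "(if P xs then f xs else g xs) = of_bool (P xs) * f xs + (1 - of_bool (P xs)) * g xs"
    for xs by auto
  show ?thesis unfolding eq
    by (intro computable_intros assms assms(1)[unfolded decidable_def])
qed

lemma computable_div [computable_intros]:
  assumes "computable k f" "computable k g"
  shows "computable k (\<lambda>xs. f xs div g xs)"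
proof -
  have eq: "m div n = (if n = 0 then 0 else \<Sum>i<m. if Suc i * n \<le> m then 1 else 0)" for m n :: nat
  proof (cases "n = 0")
    case False
    have "i < m \<and> Suc i * n \<le> m \<longleftrightarrow> i < m div n" for i
      using less_eq_div_iff_mult_less_eq[of n "Suc i" m] False div_le_dividend[of m n] by linarith
    then have "{i. i < m \<and> Suc i * n \<le> m} = {..<m div n}" by blast
    moreover have "(\<Sum>i<m. if Suc i * n \<le> m then 1 else 0) = card {i. i < m \<and> Suc i * n \<le> m}"
      by (simp add: sum.If_cases lessThan_def Collect_conj_eq del: mult_Suc)
    ultimately show ?thesis using False by simp
  qed auto
  show ?thesis unfolding eq by (intro computable_intros computable_tl assms) auto
qed

section \<open>Rational-valued recursive functions\<close>

lemma recursive_rat_fnI: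
  assumes "computable k a" "computable k b" "computable k c"
    and "\<And>xs. length xs = k \<Longrightarrow> c xs \<noteq> 0"
    and "\<And>xs. length xs = k \<Longrightarrow> f xs = (of_nat (a xs) - of_nat (b xs)) / of_nat (c xs)"
  shows "recursive_rat_fn k f"
proof -
  obtain a' b' c' where "recursive_fn k a'" "recursive_fn k b'" "recursive_fn k c'"
    "\<forall>xs. length xs = k \<longrightarrow> a xs = a' xs" "\<forall>xs. length xs = k \<longrightarrow> b xs = b' xs"
    "\<forall>xs. length xs = k \<longrightarrow> c xs = c' xs"
    using assms(1-3) unfolding computable_def by auto
  then show ?thesis
    unfolding recursive_rat_fn_def using assms(4,5)
    by (intro exI[of _ a'] exI[of _ b'] exI[of _ c']) auto
qed

lemma recursive_rat_fnE:
  assumes "recursive_rat_fn k f"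
  obtains a b c where "computable k a" "computable k b" "computable k c"
    and "\<And>xs. length xs = k \<Longrightarrow> c xs \<noteq> 0"
    and "\<And>xs. length xs = k \<Longrightarrow> f xs = (of_nat (a xs) - of_nat (b xs)) / of_nat (c xs)"
  using assms unfolding recursive_rat_fn_def computable_def by metis

lemma recursive_rat_fn_of_nat [computable_intros]:
  "computable k f \<Longrightarrow> recursive_rat_fn k (\<lambda>xs. of_nat (f xs))"
  by (rule recursive_rat_fnI[of k f "\<lambda>_. 0" "\<lambda>_. 1"]) (simp_all add: computable_const)

lemma recursive_rat_fn_inverse [computable_intros]:
  assumes "computable k f" "\<And>xs. f xs \<noteq> 0"
  shows "recursive_rat_fn k (\<lambda>xs. inverse (of_nat (f xs)))"
  by (rule recursive_rat_fnI[of k "\<lambda>_. 1" "\<lambda>_. 0" f])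
     (use assms in \<open>simp_all add: computable_const inverse_eq_divide\<close>)

lemma recursive_rat_fn_diff [computable_intros]:
  assumes "recursive_rat_fn k f" "recursive_rat_fn k g"
  shows "recursive_rat_fn k (\<lambda>xs. f xs - g xs)"
  using assms(1)
proof (rule recursive_rat_fnE)
  fix a b c assume f: "computable k a" "computable k b" "computable k c"
    "\<And>xs. length xs = k \<Longrightarrow> c xs \<noteq> 0"
    "\<And>xs. length xs = k \<Longrightarrow> f xs = (of_nat (a xs) - of_nat (b xs)) / of_nat (c xs)"
  obtain a' b' c' where g: "computable k a'" "computable k b'" "computable k c'"
    "\<And>xs. length xs = k \<Longrightarrow> c' xs \<noteq> 0"
    "\<And>xs. length xs = k \<Longrightarrow> g xs = (of_nat (a' xs) - of_nat (b' xs)) / of_nat (c' xs)"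
    using assms(2) by (rule recursive_rat_fnE) blast
  show ?thesis
  proof (rule recursive_rat_fnI)
    show "computable k (\<lambda>xs. a xs * c' xs + b' xs * c xs)" "computable k (\<lambda>xs. b xs * c' xs + a' xs * c xs)"
      "computable k (\<lambda>xs. c xs * c' xs)"
      by (intro computable_intros f(1-3) g(1-3))+
    fix xs :: "nat list" assume xs: "length xs = k"
    show "c xs * c' xs \<noteq> 0" using f(4)[OF xs] g(4)[OF xs] by simp
    show "f xs - g xs = (of_nat (a xs * c' xs + b' xs * c xs) - of_nat (b xs * c' xs + a' xs * c xs))
        / of_nat (c xs * c' xs)"
      unfolding f(5)[OF xs] g(5)[OF xs] using f(4)[OF xs] g(4)[OF xs] by (simp add: field_simps)
  qed
qed

lemma recursive_rat_fn_mult [computable_intros]: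
  assumes "recursive_rat_fn k f" "recursive_rat_fn k g"
  shows "recursive_rat_fn k (\<lambda>xs. f xs * g xs)"
  using assms(1)
proof (rule recursive_rat_fnE)
  fix a b c assume f: "computable k a" "computable k b" "computable k c"
    "\<And>xs. length xs = k \<Longrightarrow> c xs \<noteq> 0"
    "\<And>xs. length xs = k \<Longrightarrow> f xs = (of_nat (a xs) - of_nat (b xs)) / of_nat (c xs)"
  obtain a' b' c' where g: "computable k a'" "computable k b'" "computable k c'"
    "\<And>xs. length xs = k \<Longrightarrow> c' xs \<noteq> 0"
    "\<And>xs. length xs = k \<Longrightarrow> g xs = (of_nat (a' xs) - of_nat (b' xs)) / of_nat (c' xs)"
    using assms(2) by (rule recursive_rat_fnE) blast
  show ?thesis
  proof (rule recursive_rat_fnI)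
    show "computable k (\<lambda>xs. a xs * a' xs + b xs * b' xs)" "computable k (\<lambda>xs. a xs * b' xs + b xs * a' xs)"
      "computable k (\<lambda>xs. c xs * c' xs)"
      by (intro computable_intros f(1-3) g(1-3))+
    fix xs :: "nat list" assume xs: "length xs = k"
    show "c xs * c' xs \<noteq> 0" using f(4)[OF xs] g(4)[OF xs] by simp
    show "f xs * g xs = (of_nat (a xs * a' xs + b xs * b' xs) - of_nat (a xs * b' xs + b xs * a' xs))
        / of_nat (c xs * c' xs)"
      unfolding f(5)[OF xs] g(5)[OF xs] using f(4)[OF xs] g(4)[OF xs] by (simp add: field_simps)
  qed
qed

lemma recursive_rat_fn_uminus [computable_intros]:
  assumes "recursive_rat_fn k f"
  shows "recursive_rat_fn k (\<lambda>xs. - f xs)"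
  using recursive_rat_fn_diff[OF recursive_rat_fn_of_nat[OF computable_const[of k 0]] assms] by simp

lemma recursive_rat_fn_add [computable_intros]:
  assumes "recursive_rat_fn k f" "recursive_rat_fn k g"
  shows "recursive_rat_fn k (\<lambda>xs. f xs + g xs)"
  using recursive_rat_fn_diff[OF assms(1) recursive_rat_fn_uminus[OF assms(2)]] by simp

lemma recursive_rat_fn_const [computable_intros]: "recursive_rat_fn k (\<lambda>xs. q)"
proof -
  obtain m n where mn: "quotient_of q = (m, n)" by (cases "quotient_of q")
  have n: "0 < n" using mn by (rule quotient_of_denom_pos)
  show ?thesis
  proof (rule recursive_rat_fnI)
    show "q = (of_nat (nat m) - of_nat (nat (- m))) / of_nat (nat n)"
      using quotient_of_div[OF mn] n by (cases "0 \<le> m") auto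
  qed (use n in \<open>simp_all add: computable_const\<close>)
qed

lemma decidable_rat_le [computable_intros]:
  assumes "recursive_rat_fn k f" "recursive_rat_fn k g"
  shows "decidable k (\<lambda>xs. f xs \<le> g xs)"
proof -
  have "recursive_rat_fn k (\<lambda>xs. g xs - f xs)" by (intro computable_intros assms)
  then obtain a b c where h: "computable k a" "computable k b" "computable k c"
    "\<And>xs. length xs = k \<Longrightarrow> c xs \<noteq> 0"
    "\<And>xs. length xs = k \<Longrightarrow> g xs - f xs = (of_nat (a xs) - of_nat (b xs)) / of_nat (c xs)"
    by (rule recursive_rat_fnE) blast
  have "decidable k (\<lambda>xs. b xs \<le> a xs)" by (intro computable_intros h)
  then show ?thesis unfolding decidable_def
  proof (rule computable_cong)
    fix xs :: "nat list" assume xs: "length xs = k"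
    have "f xs \<le> g xs \<longleftrightarrow> 0 \<le> (of_nat (a xs) - of_nat (b xs) :: rat) / of_nat (c xs)"
      using h(5)[OF xs] by (metis diff_ge_0_iff_ge)
    also have "\<dots> \<longleftrightarrow> b xs \<le> a xs"
      using h(4)[OF xs] by (simp add: zero_le_divide_iff)
    finally show "of_bool (f xs \<le> g xs) = (of_bool (b xs \<le> a xs) :: nat)" by simp
  qed
qed

lemma recursive_rat_fn_if [computable_intros]:
  assumes "decidable k P" "recursive_rat_fn k f" "recursive_rat_fn k g"
  shows "recursive_rat_fn k (\<lambda>xs. if P xs then f xs else g xs)"
proof -
  have eq: "(if P xs then f xs else g xs) =
      of_nat (of_bool (P xs)) * f xs + of_nat (1 - of_bool (P xs)) * g xs" for xs by auto
  show ?thesis unfolding eq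
    by (intro computable_intros assms assms(1)[unfolded decidable_def])
qed

lemma recursive_rat_fn_sum [computable_intros]:
  assumes n: "computable k n" and f: "recursive_rat_fn (Suc k) (\<lambda>ys. f (hd ys) (tl ys))"
  shows "recursive_rat_fn k (\<lambda>xs. \<Sum>i<n xs. f i xs)"
  using f
proof (rule recursive_rat_fnE)
  fix a b c assume h: "computable (Suc k) a" "computable (Suc k) b" "computable (Suc k) c"
    "\<And>xs. length xs = Suc k \<Longrightarrow> c xs \<noteq> 0"
    "\<And>xs. length xs = Suc k \<Longrightarrow> f (hd xs) (tl xs) = (of_nat (a xs) - of_nat (b xs)) / of_nat (c xs)"
  \<comment> \<open>The product of all denominators serves as the common denominator of the sum.\<close>
  define C where "C xs = (\<Prod>i<n xs. c (i # xs))" for xs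
  have cons: "computable (Suc k) (\<lambda>ys. u (hd ys # tl ys))" if "computable (Suc k) u" for u
    using that by (rule computable_cong) (metis length_greater_0_conv list.collapse zero_less_Suc)
  have C: "computable k C"
    unfolding C_def by (intro computable_intros n cons h)
  show ?thesis
  proof (rule recursive_rat_fnI)
    show "computable k (\<lambda>xs. \<Sum>i<n xs. a (i # xs) * (C xs div c (i # xs)))"
      by (intro computable_intros computable_tl n cons h C)
    show "computable k (\<lambda>xs. \<Sum>i<n xs. b (i # xs) * (C xs div c (i # xs)))"
      by (intro computable_intros computable_tl n cons h C)
    show "computable k C" by fact
    fix xs :: "nat list" assume xs: "length xs = k"
    have c0: "c (i # xs) \<noteq> 0" for i using h(4) xs by simp
    then show C0: "C xs \<noteq> 0" unfolding C_def by simp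
    have "f i xs = (of_nat (a (i # xs) * (C xs div c (i # xs))) -
              of_nat (b (i # xs) * (C xs div c (i # xs)))) / of_nat (C xs)" if "i < n xs" for i
    proof -
      have "c (i # xs) dvd C xs" unfolding C_def using that by (intro dvd_prodI) auto
      then obtain t where t: "C xs = c (i # xs) * t" ..
      have eq: "f i xs = (of_nat (a (i # xs)) - of_nat (b (i # xs))) / of_nat (c (i # xs))"
        using h(5)[of "i # xs"] xs by simp
      show ?thesis using c0[of i] C0 unfolding eq t by (simp add: field_simps)
    qed
    then show "(\<Sum>i<n xs. f i xs) = (of_nat (\<Sum>i<n xs. a (i # xs) * (C xs div c (i # xs))) -
        of_nat (\<Sum>i<n xs. b (i # xs) * (C xs div c (i # xs)))) / of_nat (C xs)"
      by (simp add: sum_subtractf sum_divide_distrib diff_divide_distrib)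
  qed
qed

text \<open>
  Nonnegativity allows a representation of each factor as a quotient of natural numbers, in which
  the truncated difference is the true one; a product of differences would need all mixed terms.
\<close>

lemma recursive_rat_fn_prod:
  assumes n: "computable k n" and f: "recursive_rat_fn (Suc k) (\<lambda>ys. f (hd ys) (tl ys))"
    and nonneg: "\<And>i xs. 0 \<le> f i xs"
  shows "recursive_rat_fn k (\<lambda>xs. \<Prod>i<n xs. f i xs)"
  using f
proof (rule recursive_rat_fnE)
  fix a b c assume h: "computable (Suc k) a" "computable (Suc k) b" "computable (Suc k) c"
    "\<And>xs. length xs = Suc k \<Longrightarrow> c xs \<noteq> 0"
    "\<And>xs. length xs = Suc k \<Longrightarrow> f (hd xs) (tl xs) = (of_nat (a xs) - of_nat (b xs)) / of_nat (c xs)"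
  have cons: "computable (Suc k) (\<lambda>ys. u (hd ys # tl ys))" if "computable (Suc k) u" for u
    using that by (rule computable_cong) (metis length_greater_0_conv list.collapse zero_less_Suc)
  show ?thesis
  proof (rule recursive_rat_fnI)
    show "computable k (\<lambda>xs. \<Prod>i<n xs. a (i # xs) - b (i # xs))"
      by (intro computable_intros n cons h)
    show "computable k (\<lambda>xs. 0)" by (rule computable_const)
    show "computable k (\<lambda>xs. \<Prod>i<n xs. c (i # xs))"
      by (intro computable_intros n cons h)
    fix xs :: "nat list" assume xs: "length xs = k"
    have c0: "c (i # xs) \<noteq> 0" for i using h(4) xs by simp
    then show "(\<Prod>i<n xs. c (i # xs)) \<noteq> 0" by simp
    have "f i xs = of_nat (a (i # xs) - b (i # xs)) / of_nat (c (i # xs))" for i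
    proof -
      have eq: "f i xs = (of_nat (a (i # xs)) - of_nat (b (i # xs))) / of_nat (c (i # xs))"
        using h(5)[of "i # xs"] xs by simp
      then have "b (i # xs) \<le> a (i # xs)"
        using nonneg[of i xs] c0[of i] by (simp add: zero_le_divide_iff)
      with eq show ?thesis by (simp add: of_nat_diff)
    qed
    then show "(\<Prod>i<n xs. f i xs) = (of_nat (\<Prod>i<n xs. a (i # xs) - b (i # xs)) - of_nat 0) /
        of_nat (\<Prod>i<n xs. c (i # xs))"
      by (simp add: prod_dividef)
  qed
qed

lemma recursive_rat_fn_comp:
  assumes f: "recursive_rat_fn (length gs) f" and gs: "\<And>g. g \<in> set gs \<Longrightarrow> computable k g"
  shows "recursive_rat_fn k (\<lambda>xs. f (map (\<lambda>g. g xs) gs))"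
  using f
proof (rule recursive_rat_fnE)
  fix a b c assume "computable (length gs) a" "computable (length gs) b" "computable (length gs) c"
    and "\<And>xs. length xs = length gs \<Longrightarrow> c xs \<noteq> 0"
    and "\<And>xs. length xs = length gs \<Longrightarrow> f xs = (of_nat (a xs) - of_nat (b xs)) / of_nat (c xs)"
  then show ?thesis
    by (intro recursive_rat_fnI[of k "\<lambda>xs. a (map (\<lambda>g. g xs) gs)" "\<lambda>xs. b (map (\<lambda>g. g xs) gs)"
          "\<lambda>xs. c (map (\<lambda>g. g xs) gs)"] computable_comp gs) auto
qed

section \<open>Computing with codes of strings\<close>

lemma string_code_Nil [simp]: "string_code [] = 0"
  by (simp add: string_code_def)

text \<open>
  In binary, \<open>string_code \<sigma> + 1\<close> is the digit 1 followed by \<open>\<sigma>\<close>, so appending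
  \<open>\<tau>\<close> shifts by \<open>length \<tau>\<close> binary places.
\<close>

lemma string_code_append: "string_code (\<sigma> @ \<tau>) = string_code \<sigma> * 2 ^ length \<tau> + string_code \<tau>"
proof (induction \<tau> rule: rev_induct)
  case (snoc b \<tau>)
  have "string_code (\<rho> @ [b]) = 2 * string_code \<rho> + (if b then 2 else 1)" for \<rho>
    by (simp add: string_code_def)
  from this[of "\<sigma> @ \<tau>"] this[of \<tau>] show ?case using snoc by simp
qed simp

lemma string_code_snoc: "string_code (\<sigma> @ [b]) = 2 * string_code \<sigma> + (if b then 2 else 1)"
  by (simp add: string_code_def)

fun string_of_code :: "nat \<Rightarrow> string2" where
  "string_of_code 0 = []"
| "string_of_code (Suc n) = string_of_code (n div 2) @ [odd n]"

lemma string_of_code_string_code [simp]: "string_of_code (string_code \<sigma>) = \<sigma>"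
proof (induction \<sigma> rule: rev_induct)
  case (snoc b \<sigma>)
  then show ?case by (cases b) (simp_all add: string_code_snoc)
qed simp

lemma string_code_string_of_code [simp]: "string_code (string_of_code n) = n"
proof (induction n rule: string_of_code.induct)
  case (2 n)
  then show ?case by (cases "even n") (auto simp: string_code_snoc elim!: evenE oddE)
qed simp

lemma string_code_inject: "string_code \<sigma> = string_code \<tau> \<longleftrightarrow> \<sigma> = \<tau>"
  by (metis string_of_code_string_code)

lemma length_string_of_code_le: "length (string_of_code n) \<le> n"
proof (induction n rule: string_of_code.induct)
  case (2 n)
  then show ?case using div_le_dividend[of n 2] by (simp del: div_le_dividend)
qed simp

lemma string_code_bounds:
  "2 ^ length \<sigma> \<le> Suc (string_code \<sigma>)" "Suc (string_code \<sigma>) < 2 ^ Suc (length \<sigma>)"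
  by (induction \<sigma> rule: rev_induct) (auto simp: string_code_snoc)

lemma string_code_take:
  "string_code (take m \<sigma>) = Suc (string_code \<sigma>) div 2 ^ (length \<sigma> - m) - 1"
proof -
  have "Suc (string_code \<sigma>) = string_code (take m \<sigma>) * 2 ^ (length \<sigma> - m) + Suc (string_code (drop m \<sigma>))"
    using string_code_append[of "take m \<sigma>" "drop m \<sigma>"] by simp
  also have "\<dots> = Suc (string_code (drop m \<sigma>)) - 2 ^ (length \<sigma> - m) + Suc (string_code (take m \<sigma>)) * 2 ^ (length \<sigma> - m)"
    using string_code_bounds(1)[of "drop m \<sigma>"] by simp
  finally have eq: "Suc (string_code \<sigma>) = \<dots>" .
  have "Suc (string_code (drop m \<sigma>)) - 2 ^ (length \<sigma> - m) < 2 ^ (length \<sigma> - m)"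
    using string_code_bounds(2)[of "drop m \<sigma>"] by simp
  then have "Suc (string_code \<sigma>) div 2 ^ (length \<sigma> - m) = Suc (string_code (take m \<sigma>))"
    unfolding eq by (subst div_mult_self1) simp_all
  then show ?thesis by simp
qed

text \<open>
  The length is the integer part of the binary logarithm of \<open>string_code \<sigma> + 1\<close>; counting powers
  of two makes it a bounded sum, hence recursive.
\<close>

lemma length_eq_card_powers:
  "length \<sigma> = (\<Sum>i<string_code \<sigma>. if 2 ^ Suc i \<le> Suc (string_code \<sigma>) then 1 else 0)"
proof -
  have "i < string_code \<sigma> \<and> 2 ^ Suc i \<le> Suc (string_code \<sigma>) \<longleftrightarrow> i < length \<sigma>" for i
  proof -
    have "2 ^ Suc i \<le> Suc (string_code \<sigma>) \<longleftrightarrow> i < length \<sigma>"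
    proof
      assume "2 ^ Suc i \<le> Suc (string_code \<sigma>)"
      then have "(2::nat) ^ Suc i < 2 ^ Suc (length \<sigma>)"
        using string_code_bounds(2)[of \<sigma>] by (rule le_less_trans)
      then show "i < length \<sigma>" by (simp del: power_Suc)
    next
      assume "i < length \<sigma>"
      then have "(2::nat) ^ Suc i \<le> 2 ^ length \<sigma>" by (intro power_increasing) auto
      then show "2 ^ Suc i \<le> Suc (string_code \<sigma>)" using string_code_bounds(1) by (rule le_trans)
    qed
    moreover have "length \<sigma> \<le> string_code \<sigma>"
      using length_string_of_code_le[of "string_code \<sigma>"] by simp
    ultimately show ?thesis by linarith
  qed
  then have "{i. i < string_code \<sigma> \<and> 2 ^ Suc i \<le> Suc (string_code \<sigma>)} = {..<length \<sigma>}"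
    by blast
  moreover have "(\<Sum>i<n. if P i then 1 else 0) = card {i. i < n \<and> P i}" for n :: nat and P
    by (simp add: sum.If_cases lessThan_def Collect_conj_eq)
  ultimately show ?thesis by (simp del: power_Suc)
qed

definition computable_string :: "nat \<Rightarrow> (nat list \<Rightarrow> string2) \<Rightarrow> bool" where
  "computable_string k s \<longleftrightarrow> computable k (\<lambda>xs. string_code (s xs))"

lemma computable_string_of_code [computable_intros]:
  "computable k f \<Longrightarrow> computable_string k (\<lambda>xs. string_of_code (f xs))"
  by (simp add: computable_string_def)

lemma computable_string_const [computable_intros]: "computable_string k (\<lambda>xs. \<sigma>)"
  by (simp add: computable_string_def computable_const)

lemma computable_string_tl:
  "computable_string k s \<Longrightarrow> computable_string (Suc k) (\<lambda>ys. s (tl ys))"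
  unfolding computable_string_def by (rule computable_tl)

lemma computable_length [computable_intros]:
  assumes "computable_string k s"
  shows "computable k (\<lambda>xs. length (s xs))"
  unfolding length_eq_card_powers
  by (intro computable_intros computable_tl assms[unfolded computable_string_def]) auto

lemma computable_string_append [computable_intros]:
  assumes "computable_string k s" "computable_string k t"
  shows "computable_string k (\<lambda>xs. s xs @ t xs)"
  unfolding computable_string_def string_code_append
  by (intro computable_intros assms assms[unfolded computable_string_def])

lemma computable_string_take [computable_intros]:
  assumes "computable k n" "computable_string k s"
  shows "computable_string k (\<lambda>xs. take (n xs) (s xs))"
  unfolding computable_string_def string_code_take
  by (intro computable_intros assms assms[unfolded computable_string_def])

lemma computable_string_drop [computable_intros]:
  assumes "computable k n" "computable_string k s"
  shows "computable_string k (\<lambda>xs. drop (n xs) (s xs))"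
proof -
  have eq: "string_code (drop m \<sigma>) = string_code \<sigma> - string_code (take m \<sigma>) * 2 ^ (length \<sigma> - m)"
    for m \<sigma>
    using string_code_append[of "take m \<sigma>" "drop m \<sigma>"] by simp
  show ?thesis
    unfolding computable_string_def eq
    by (intro computable_intros assms assms[unfolded computable_string_def]
        computable_string_take[OF assms, unfolded computable_string_def])
qed

lemma computable_string_if [computable_intros]:
  assumes "decidable k P" "computable_string k s" "computable_string k t"
  shows "computable_string k (\<lambda>xs. if P xs then s xs else t xs)"
  unfolding computable_string_def if_distrib[of string_code]
  by (intro computable_intros assms assms[unfolded computable_string_def])

lemma decidable_string_eq [computable_intros]:
  assumes "computable_string k s" "computable_string k t"
  shows "decidable k (\<lambda>xs. s xs = t xs)"
  unfolding string_code_inject[symmetric]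
  by (intro computable_intros assms assms[unfolded computable_string_def])

lemma computable_string_rec_nat [computable_intros]:
  assumes n: "computable k n" and s: "computable_string k s"
    and h: "computable_string (Suc (Suc k))
      (\<lambda>ys. h (hd ys) (string_of_code (hd (tl ys))) (tl (tl ys)))"
  shows "computable_string k (\<lambda>xs. rec_nat (s xs) (\<lambda>y r. h y r xs) (n xs))"
proof -
  have eq: "string_code (rec_nat (s xs) (\<lambda>y r. h y r xs) m) =
      rec_nat (string_code (s xs)) (\<lambda>y r. string_code (h y (string_of_code r) xs)) m" for xs m
  proof (induction m)
    case (Suc m)
    show ?case by (simp flip: Suc)
  qed simp
  show ?thesis
    unfolding computable_string_def eq
    by (intro computable_intros assms[unfolded computable_string_def])
qed

section \<open>Rational-valued computable functions on strings\<close>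

definition computable_rat_valued :: "(string2 \<Rightarrow> rat) \<Rightarrow> bool" where
  "computable_rat_valued Q \<longleftrightarrow> recursive_rat_fn 1 (\<lambda>xs. Q (string_of_code (hd xs)))"

lemma recursive_rat_fn_apply:
  assumes "computable_rat_valued Q" "computable_string k s"
  shows "recursive_rat_fn k (\<lambda>xs. Q (s xs))"
  using recursive_rat_fn_comp[of "[\<lambda>xs. string_code (s xs)]" "\<lambda>xs. Q (string_of_code (hd xs))" k]
    assms by (simp add: computable_rat_valued_def computable_string_def)

lemma recursive_rat_fn_cong:
  assumes "recursive_rat_fn k g" "\<And>xs. length xs = k \<Longrightarrow> f xs = g xs"
  shows "recursive_rat_fn k f"
  using assms unfolding recursive_rat_fn_def by auto

lemma exactly_computable_iff:
  "exactly_computable d \<longleftrightarrow> (\<exists>Q. computable_rat_valued Q \<and> d = (\<lambda>\<sigma>. of_rat (Q \<sigma>)))"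
proof
  assume "exactly_computable d"
  then obtain f where f: "recursive_rat_fn 1 f" "\<And>\<sigma>. d \<sigma> = of_rat (f [string_code \<sigma>])"
    unfolding exactly_computable_def by blast
  have "recursive_rat_fn 1 (\<lambda>xs. f [string_code (string_of_code (hd xs))])"
    by (rule recursive_rat_fn_cong[OF f(1)]) (auto simp: length_Suc_conv)
  then have "computable_rat_valued (\<lambda>\<sigma>. f [string_code \<sigma>])"
    by (simp only: computable_rat_valued_def)
  then show "\<exists>Q. computable_rat_valued Q \<and> d = (\<lambda>\<sigma>. of_rat (Q \<sigma>))" using f(2) by blast
next
  assume "\<exists>Q. computable_rat_valued Q \<and> d = (\<lambda>\<sigma>. of_rat (Q \<sigma>))"
  then show "exactly_computable d"
    unfolding exactly_computable_def computable_rat_valued_def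
    by (metis list.sel(1) string_of_code_string_code)
qed

lemma computable_real_valued_of_rat:
  assumes "computable_rat_valued Q"
  shows "computable_real_valued (\<lambda>\<sigma>. of_rat (Q \<sigma>))"
  unfolding computable_real_valued_def
proof (intro exI conjI allI)
  show "recursive_rat_fn 2 (\<lambda>xs. Q (string_of_code (hd xs)))"
    by (intro computable_intros recursive_rat_fn_apply[OF assms]) auto
qed simp

lemma computable_real_valued_approx:
  assumes "computable_real_valued d"
  obtains p where
    "\<And>k s n. computable_string k s \<Longrightarrow> computable k n \<Longrightarrow> recursive_rat_fn k (\<lambda>xs. p (s xs) (n xs))"
    "\<And>\<sigma> n. \<bar>d \<sigma> - of_rat (p \<sigma> n)\<bar> \<le> 1 / 2 ^ n"
proof -
  obtain f where f: "recursive_rat_fn 2 f" "\<And>\<sigma> n. \<bar>d \<sigma> - of_rat (f [string_code \<sigma>, n])\<bar> \<le> 1 / 2 ^ n"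
    using assms unfolding computable_real_valued_def by blast
  have "recursive_rat_fn k (\<lambda>xs. f [string_code (s xs), n xs])"
    if "computable_string k s" "computable k n" for k s n
    using recursive_rat_fn_comp[of "[\<lambda>xs. string_code (s xs), n]" f k] f(1) that
    by (auto simp: computable_string_def numeral_2_eq_2)
  with f(2) show ?thesis by (intro that[of "\<lambda>\<sigma> n. f [string_code \<sigma>, n]"])
qed

section \<open>Martingales and cylinders\<close>

text \<open>
  A real sequence that is unbounded exceeds every bound infinitely often, because finitely many of its terms are
  bounded; this is why an infinite limit superior means no more than being unbounded.
\<close>

lemma succeeds_on_iff: "succeeds_on d X \<longleftrightarrow> (\<forall>M. \<exists>n. M < d (initial_segment X n))"
proof
  assume lim: "succeeds_on d X"
  show "\<forall>M. \<exists>n. M < d (initial_segment X n)"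
  proof (rule allI, rule ccontr)
    fix M assume "\<nexists>n. M < d (initial_segment X n)"
    then have "limsup (\<lambda>n. ereal (d (initial_segment X n))) \<le> ereal M"
      by (intro Limsup_bounded) (simp add: not_less)
    then show False using lim by (simp add: succeeds_on_def)
  qed
next
  assume unbounded: "\<forall>M. \<exists>n. M < d (initial_segment X n)"
  have "\<exists>n\<ge>m. M < d (initial_segment X n)" for M m
  proof -
    define K where "K = Max (insert M ((\<lambda>n. d (initial_segment X n)) ` {..<m}))"
    obtain n where n: "K < d (initial_segment X n)" using unbounded by blast
    have "M \<le> K" and "\<And>i. i < m \<Longrightarrow> d (initial_segment X i) \<le> K" by (auto simp: K_def)
    with n have "M < d (initial_segment X n)" "\<not> n < m" by (auto simp: not_less[symmetric])
    then show ?thesis by (intro exI[of _ n]) auto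
  qed
  then have "(SUP n\<in>{m..}. ereal (d (initial_segment X n))) = \<infinity>" for m
    by (intro SUP_PInfty) (metis atLeast_iff ereal_less_eq(3) less_imp_le)
  then show "succeeds_on d X"
    unfolding succeeds_on_def limsup_INF_SUP by simp
qed

lemma length_initial_segment [simp]: "length (initial_segment X n) = n"
  by (simp add: initial_segment_def)

lemma initial_segment_add:
  "initial_segment X (m + n) = initial_segment X m @ initial_segment (tail m X) n"
  by (rule nth_equalityI) (auto simp: initial_segment_def tail_def nth_append)

lemma cylinder_append: "X \<in> cylinder (\<sigma> @ \<tau>) \<longleftrightarrow> X \<in> cylinder \<sigma> \<and> tail (length \<sigma>) X \<in> cylinder \<tau>"
  by (auto simp: cylinder_def initial_segment_add)

lemma mem_open_of_minimal_strings:
  assumes "P (initial_segment X n)"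
  shows "X \<in> open_of (minimal_strings P)"
proof -
  define m where "m = (LEAST n. P (initial_segment X n))"
  have "P (initial_segment X m)" unfolding m_def using assms by (rule LeastI)
  moreover have "\<not> P \<tau>" if "strict_prefix \<tau> (initial_segment X m)" for \<tau>
  proof -
    have "length \<tau> < m" using prefix_length_less[OF that] by simp
    moreover from this have "\<tau> = initial_segment X (length \<tau>)"
      using that initial_segment_add[of X "length \<tau>" "m - length \<tau>"]
      by (auto simp: strict_prefix_def prefix_def)
    ultimately show ?thesis using not_less_Least[of "length \<tau>" "\<lambda>n. P (initial_segment X n)"]
      unfolding m_def by metis
  qed
  ultimately have "initial_segment X m \<in> minimal_strings P" by (simp add: minimal_strings_def)
  then show ?thesis unfolding open_of_def cylinder_def by force
qed

lemma martingale_nonneg: "martingale d \<Longrightarrow> 0 \<le> d \<sigma>"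
  by (simp add: martingale_def)

lemma martingale_avg: "martingale d \<Longrightarrow> d \<sigma> = (d (\<sigma> @ [False]) + d (\<sigma> @ [True])) / 2"
  unfolding martingale_def by blast

lemma martingale_append_le:
  assumes "martingale d" shows "d (\<sigma> @ \<tau>) \<le> 2 ^ length \<tau> * d \<sigma>"
proof (induction \<tau> rule: rev_induct)
  case (snoc b \<tau>)
  have "d (\<sigma> @ \<tau> @ [b]) \<le> 2 * d (\<sigma> @ \<tau>)"
    using martingale_avg[OF assms, of "\<sigma> @ \<tau>"] martingale_nonneg[OF assms, of "\<sigma> @ \<tau> @ [True]"]
      martingale_nonneg[OF assms, of "\<sigma> @ \<tau> @ [False]"] by (cases b) simp_all
  with snoc show ?case by simp
qed simp

lemma martingale_le:
  assumes "martingale d" "d [] = 1" shows "d \<sigma> \<le> 2 ^ length \<sigma>"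
  using martingale_append_le[OF assms(1), of "[]" \<sigma>] assms(2) by simp

section \<open>Rounding the bets of a martingale to rationals\<close>

text \<open>
  The total won or lost along \<open>\<sigma>\<close> by a gambler who at \<open>\<rho>\<close> bets the (possibly negative) amount
  \<open>\<delta> \<rho>\<close> on the next bit being \<open>False\<close>.
\<close>

definition net_gain :: "(string2 \<Rightarrow> rat) \<Rightarrow> string2 \<Rightarrow> rat" where
  "net_gain \<delta> \<sigma> = (\<Sum>i<length \<sigma>.
     if take (Suc i) \<sigma> = take i \<sigma> @ [False] then \<delta> (take i \<sigma>) else - \<delta> (take i \<sigma>))"

lemma net_gain_snoc:
  "net_gain \<delta> (\<sigma> @ [b]) = net_gain \<delta> \<sigma> + (if b then - \<delta> \<sigma> else \<delta> \<sigma>)"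
  unfolding net_gain_def by (auto intro!: sum.cong)

text \<open>
  The bet of \<open>d\<close> at \<open>\<sigma>\<close> is half of the difference of its values at the two successors.  It is
  approximated with error at most \<open>2 ^ - (length \<sigma> + 3)\<close>, so that the errors
  along any string add up to less than \<open>1 / 4\<close>.  The rounded bets are fair by construction; starting with
  capital \<open>c\<close>, an integer at least \<open>d [] + 1\<close>, they lead to a capital that stays above \<open>d\<close>, hence is nonnegative and
  unbounded wherever \<open>d\<close> is.  Division by \<open>c\<close> makes the initial capital 1.
\<close>

lemma rational_martingale:
  assumes d: "martingale d" "computable_real_valued d"
  obtains Q where "computable_rat_valued Q" "martingale (\<lambda>\<sigma>. of_rat (Q \<sigma>))" "Q [] = 1"
    "\<And>X. succeeds_on d X \<Longrightarrow> succeeds_on (\<lambda>\<sigma>. of_rat (Q \<sigma>)) X"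
proof -
  obtain p where p:
    "\<And>k s n. computable_string k s \<Longrightarrow> computable k n \<Longrightarrow> recursive_rat_fn k (\<lambda>xs. p (s xs) (n xs))"
    "\<And>\<sigma> n. \<bar>d \<sigma> - of_rat (p \<sigma> n)\<bar> \<le> 1 / 2 ^ n"
    using computable_real_valued_approx[OF d(2)] by blast
  define \<delta> where "\<delta> \<sigma> = (p (\<sigma> @ [False]) (length \<sigma> + 3) - p (\<sigma> @ [True]) (length \<sigma> + 3)) * (1 / 2)" for \<sigma>
  define c where "c = Suc (nat \<lceil>d []\<rceil>)"
  define Q where "Q \<sigma> = 1 + net_gain \<delta> \<sigma> * inverse (of_nat c)" for \<sigma>
  have c0: "0 < real c" by (simp add: c_def)
  have c: "d [] + 1 \<le> real c" unfolding c_def by linarith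
  have \<delta>: "\<bar>of_rat (\<delta> \<sigma>) - (d (\<sigma> @ [False]) - d \<sigma>)\<bar> \<le> 1 / 2 ^ length \<sigma> / 8"
      "\<bar>- of_rat (\<delta> \<sigma>) - (d (\<sigma> @ [True]) - d \<sigma>)\<bar> \<le> 1 / 2 ^ length \<sigma> / 8" for \<sigma>
  proof -
    have eq: "1 / 2 ^ length \<sigma> / 8 = 1 / (2::real) ^ (length \<sigma> + 3)" by (simp add: power_add)
    have half: "\<bar>(a - b) / 2 - (u - v)\<bar> \<le> e"
      if "\<bar>u - a\<bar> \<le> e" "\<bar>w - b\<bar> \<le> e" "v = (u + w) / 2" for a b u v w e :: real
    proof -
      have "(a - b) / 2 - (u - v) = (w - b) / 2 - (u - a) / 2" unfolding that(3) by (simp add: field_simps)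
      also have "\<bar>\<dots>\<bar> \<le> \<bar>(w - b) / 2\<bar> + \<bar>(u - a) / 2\<bar>" by (rule abs_triangle_ineq4)
      also have "\<dots> \<le> e" using that(1,2) by simp
      finally show ?thesis .
    qed
    have \<delta>_eq: "of_rat (\<delta> \<sigma>) = (of_rat (p (\<sigma> @ [False]) (length \<sigma> + 3)) -
        of_rat (p (\<sigma> @ [True]) (length \<sigma> + 3))) / (2::real)"
      by (simp add: \<delta>_def of_rat_mult of_rat_diff of_rat_divide)
    show "\<bar>of_rat (\<delta> \<sigma>) - (d (\<sigma> @ [False]) - d \<sigma>)\<bar> \<le> 1 / 2 ^ length \<sigma> / 8"
      unfolding \<delta>_eq eq by (rule half[OF p(2) p(2) martingale_avg[OF d(1)]])
    have "- of_rat (\<delta> \<sigma>) = (of_rat (p (\<sigma> @ [True]) (length \<sigma> + 3)) -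
        of_rat (p (\<sigma> @ [False]) (length \<sigma> + 3))) / (2::real)"
      unfolding \<delta>_eq by (simp only: minus_divide_left minus_diff_eq)
    then show "\<bar>- of_rat (\<delta> \<sigma>) - (d (\<sigma> @ [True]) - d \<sigma>)\<bar> \<le> 1 / 2 ^ length \<sigma> / 8"
      unfolding eq
      by (simp only:) (rule half[OF p(2) p(2)], use martingale_avg[OF d(1), of \<sigma>] in simp)
  qed
  have arith: "\<bar>f + t - (u - w)\<bar> \<le> (1 - e / 2) / 4"
    if "\<bar>t - (u - v)\<bar> \<le> e / 8" "\<bar>f - (v - w)\<bar> \<le> (1 - e) / 4" for f t u v w e :: real
  proof -
    have "\<bar>f + t - (u - w)\<bar> = \<bar>(t - (u - v)) + (f - (v - w))\<bar>" by (simp add: algebra_simps)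
    also have "\<dots> \<le> e / 8 + (1 - e) / 4"
      by (rule order_trans[OF abs_triangle_ineq add_mono[OF that]])
    also have "\<dots> = (1 - e / 2) / 4" by (simp add: field_simps)
    finally show ?thesis .
  qed
  have near: "\<bar>of_rat (net_gain \<delta> \<sigma>) - (d \<sigma> - d [])\<bar> \<le> (1 - 1 / 2 ^ length \<sigma>) / 4" for \<sigma>
  proof (induction \<sigma> rule: rev_induct)
    case Nil
    then show ?case by (simp add: net_gain_def)
  next
    case (snoc b \<sigma>)
    have "\<bar>(if b then - of_rat (\<delta> \<sigma>) else of_rat (\<delta> \<sigma>)) - (d (\<sigma> @ [b]) - d \<sigma>)\<bar> \<le> 1 / 2 ^ length \<sigma> / 8"
      using \<delta>[of \<sigma>] by (cases b) simp_all
    then have "\<bar>of_rat (net_gain \<delta> \<sigma>) + (if b then - of_rat (\<delta> \<sigma>) else of_rat (\<delta> \<sigma>)) -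
        (d (\<sigma> @ [b]) - d [])\<bar> \<le> (1 - 1 / 2 ^ length \<sigma> / 2) / 4"
      using snoc by (rule arith)
    then show ?case
      by (cases b) (simp_all add: net_gain_snoc of_rat_add of_rat_minus of_rat_diff)
  qed
  have Q: "of_rat (Q \<sigma>) = 1 + of_rat (net_gain \<delta> \<sigma>) / real c" for \<sigma>
    by (simp add: Q_def of_rat_add of_rat_mult of_rat_inverse divide_inverse)
  have near': "d \<sigma> \<le> real c * of_rat (Q \<sigma>)" for \<sigma>
  proof -
    have "(1 - 1 / 2 ^ length \<sigma>) / 4 \<le> (1 / 4 :: real)" by simp
    with near[of \<sigma>] have "\<bar>of_rat (net_gain \<delta> \<sigma>) - (d \<sigma> - d [])\<bar> \<le> 1 / 4"
      by (rule order_trans)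
    from abs_le_D2[OF this]
    have "d \<sigma> - d [] - 1 \<le> of_rat (net_gain \<delta> \<sigma>)" by simp
    moreover have "real c * of_rat (Q \<sigma>) = real c + of_rat (net_gain \<delta> \<sigma>)"
      using c0 by (simp add: Q distrib_left)
    ultimately show ?thesis using c by linarith
  qed
  show ?thesis
  proof
    show "computable_rat_valued Q"
      unfolding computable_rat_valued_def Q_def net_gain_def \<delta>_def
      by (intro computable_intros p(1)) (simp_all add: c_def)
    show "martingale (\<lambda>\<sigma>. of_rat (Q \<sigma>))"
      unfolding martingale_def
    proof (intro conjI allI)
      fix \<sigma>
      have "0 \<le> real c * of_rat (Q \<sigma>)"
        using near'[of \<sigma>] martingale_nonneg[OF d(1), of \<sigma>] by linarith
      then show "0 \<le> (of_rat (Q \<sigma>) :: real)" using c0 by (simp add: zero_le_mult_iff)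
      show "(of_rat (Q \<sigma>) :: real) = (of_rat (Q (\<sigma> @ [False])) + of_rat (Q (\<sigma> @ [True]))) / 2"
        by (simp add: Q net_gain_snoc of_rat_add of_rat_minus of_rat_diff add_divide_distrib
            diff_divide_distrib)
    qed
    show "Q [] = 1" by (simp add: Q_def net_gain_def)
    fix X assume X: "succeeds_on d X"
    show "succeeds_on (\<lambda>\<sigma>. of_rat (Q \<sigma>)) X"
      unfolding succeeds_on_iff
    proof
      fix M
      obtain n where "real c * M < d (initial_segment X n)" using X unfolding succeeds_on_iff by blast
      then have "real c * M < real c * of_rat (Q (initial_segment X n))"
        using near' by (rule less_le_trans)
      then show "\<exists>n. M < of_rat (Q (initial_segment X n))" using c0 by auto
    qed
  qed
qed

section \<open>Betting on all tails at once\<close>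

text \<open>
  The \<open>n\<close>-th string \<open>\<sigma>\<close> contributes the winnings of \<open>d\<close> on \<open>\<sigma>\<tau>\<close> that come after the first \<open>n\<close> bits of
  \<open>\<tau>\<close>.  The difference instead of the value itself makes this contribution 0 when \<open>\<sigma>\<close> enters the game,
  so that the range of the sum can grow with \<open>\<tau>\<close> without a jump in the capital.
  The weights are chosen for \<open>bet_on_all_tails_term_ge\<close>: since \<open>\<sigma>\<close> has at most \<open>n\<close> bits,
  what it can lose is at most \<open>4 ^ n\<close>, which the weight scales down to \<open>1 / 2 ^ Suc n\<close>, and all losses
  together are covered by the initial capital 1.
\<close>

definition bet_on_all_tails :: "(string2 \<Rightarrow> 'a::field) \<Rightarrow> string2 \<Rightarrow> 'a" where
  "bet_on_all_tails d \<tau> = 1 + (\<Sum>n<length \<tau>.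
     (d (string_of_code n @ \<tau>) - d (string_of_code n @ take n \<tau>)) * inverse (of_nat (2 * 8 ^ n)))"

lemma bet_on_all_tails_term_ge:
  fixes d :: "string2 \<Rightarrow> real"
  assumes "martingale d" "d [] = 1"
  shows "- (1 / 2 ^ Suc n) \<le>
    (d (string_of_code n @ \<tau>) - d (string_of_code n @ take n \<tau>)) * inverse (of_nat (2 * 8 ^ n))"
proof -
  have "d (string_of_code n @ take n \<tau>) \<le> 2 ^ (length (string_of_code n) + length (take n \<tau>))"
    using martingale_le[OF assms, of "string_of_code n @ take n \<tau>"] by simp
  also have "\<dots> \<le> 2 ^ (n + n)"
    using length_string_of_code_le[of n] by (intro power_increasing add_mono) auto
  finally have "- (2 ^ n * 2 ^ n) \<le> d (string_of_code n @ \<tau>) - d (string_of_code n @ take n \<tau>)"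
    using martingale_nonneg[OF assms(1), of "string_of_code n @ \<tau>"] by (simp add: power_add)
  then have "- (2 ^ n * 2 ^ n) * inverse (of_nat (2 * 8 ^ n)) \<le>
    (d (string_of_code n @ \<tau>) - d (string_of_code n @ take n \<tau>)) * inverse (of_nat (2 * 8 ^ n))"
    by (intro mult_right_mono) auto
  moreover have "(8::real) ^ n = 2 ^ n * (2 ^ n * 2 ^ n)"
    by (simp flip: power_mult_distrib)
  ultimately show ?thesis by (simp add: field_simps)
qed

lemma sum_halves_less: "(\<Sum>n<m. 1 / 2 ^ Suc n) < (1::real)"
proof -
  have "(\<Sum>n<m. 1 / 2 ^ Suc n) = 1 - 1 / (2::real) ^ m"
    by (induction m) (simp_all add: field_simps)
  then show ?thesis by simp
qed

text \<open>
  The winnings on one string survive in the total, because the losses on all the others are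
  covered by the initial capital.
\<close>

lemma bet_on_all_tails_ge:
  fixes d :: "string2 \<Rightarrow> real"
  assumes "martingale d" "d [] = 1" "n < length \<tau>"
  shows "(d (string_of_code n @ \<tau>) - d (string_of_code n @ take n \<tau>)) * inverse (of_nat (2 * 8 ^ n))
    \<le> bet_on_all_tails d \<tau>"
proof -
  let ?t = "\<lambda>n. (d (string_of_code n @ \<tau>) - d (string_of_code n @ take n \<tau>)) * inverse (of_nat (2 * 8 ^ n))"
  have "- 1 \<le> - (\<Sum>i<length \<tau>. 1 / (2::real) ^ Suc i)"
    using sum_halves_less[of "length \<tau>"] by linarith
  also have "\<dots> \<le> (\<Sum>i<length \<tau>. - (1 / (2::real) ^ Suc i)) + 1 / 2 ^ Suc n"
    by (simp add: sum_negf)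
  also have "\<dots> = (\<Sum>i\<in>{..<length \<tau>} - {n}. - (1 / (2::real) ^ Suc i))"
    using assms(3) by (subst sum.remove[of _ n]) simp_all
  also have "\<dots> \<le> (\<Sum>i\<in>{..<length \<tau>} - {n}. ?t i)"
    by (intro sum_mono bet_on_all_tails_term_ge assms)
  finally show ?thesis
    unfolding bet_on_all_tails_def using assms(3) by (subst sum.remove[of _ n]) auto
qed

lemma martingale_bet_on_all_tails:
  assumes d: "martingale d" "d [] = 1"
  shows "martingale (bet_on_all_tails d)"
  unfolding martingale_def
proof (intro conjI allI)
  fix \<tau>
  have "(\<Sum>n<length \<tau>. - (1 / 2 ^ Suc n)) \<le> bet_on_all_tails d \<tau> - 1"
    unfolding bet_on_all_tails_def add_diff_cancel_left' by (intro sum_mono bet_on_all_tails_term_ge d)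
  then show "0 \<le> bet_on_all_tails d \<tau>"
    using sum_halves_less[of "length \<tau>"] by (simp add: sum_negf)
  \<comment> \<open>The term for \<open>n = length \<tau>\<close> vanishes at \<open>\<tau>\<close> itself, so \<open>\<tau>\<close> and its two successors have sums over the
    same range.\<close>
  have ext: "bet_on_all_tails d (\<tau> @ \<upsilon>) = 1 + (\<Sum>n<Suc (length \<tau>).
     (d (string_of_code n @ \<tau> @ \<upsilon>) - d (string_of_code n @ take n \<tau>)) * inverse (of_nat (2 * 8 ^ n)))"
    if "length \<upsilon> \<le> 1" for \<upsilon>
    using that by (cases \<upsilon>) (auto simp: bet_on_all_tails_def intro!: sum.cong)
  let ?t = "\<lambda>\<upsilon> n. (d (string_of_code n @ \<tau> @ \<upsilon>) - d (string_of_code n @ take n \<tau>)) *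
    inverse (of_nat (2 * 8 ^ n))"
  have half: "(x - c) * u = ((y - c) * u + (z - c) * u) / 2" if "x = (y + z) / 2" for x y z c u :: real
    using that by (simp add: field_simps)
  have "?t [] n = (?t [False] n + ?t [True] n) / 2" for n
    by (rule half) (use martingale_avg[OF d(1), of "string_of_code n @ \<tau>"] in simp)
  then have "sum (?t []) A = (sum (?t [False]) A + sum (?t [True]) A) / 2" for A
    by (simp only: sum.distrib flip: sum_divide_distrib)
  then have "1 + sum (?t []) A = ((1 + sum (?t [False]) A) + (1 + sum (?t [True]) A)) / 2" for A
    by (simp only:) (simp add: field_simps)
  from this[of "{..<Suc (length \<tau>)}"]
  have "bet_on_all_tails d (\<tau> @ []) = (bet_on_all_tails d (\<tau> @ [False]) + bet_on_all_tails d (\<tau> @ [True])) / 2"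
    by (subst (1 2 3) ext) simp_all
  then show "bet_on_all_tails d \<tau> = (bet_on_all_tails d (\<tau> @ [False]) + bet_on_all_tails d (\<tau> @ [True])) / 2"
    by simp
qed

lemma bet_on_all_tails_succeeds:
  assumes d: "martingale d" "d [] = 1" and X: "succeeds_on d X"
  shows "succeeds_on (bet_on_all_tails d) (tail k X)"
  unfolding succeeds_on_iff
proof
  fix M :: real
  \<comment> \<open>The tail is compared with the string that was cut off from \<open>X\<close>.\<close>
  define n where "n = string_code (initial_segment X k)"
  define K where "K = real (2 * 8 ^ n)"
  have K: "0 < K" by (simp add: K_def)
  \<comment> \<open>The first bound forces \<open>N\<close> beyond the point \<open>k + n\<close> where the string enters the game; the second
    makes up for the value that is subtracted there and for the weight.\<close>
  obtain N where N: "max (2 ^ (k + n)) (2 ^ (k + n) + \<bar>M\<bar> * K) < d (initial_segment X N)"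
    using X unfolding succeeds_on_iff by blast
  have "2 ^ (k + n) < d (initial_segment X N)" using N by simp
  also have "\<dots> \<le> 2 ^ N" using martingale_le[OF d, of "initial_segment X N"] by simp
  finally have "k + n < N" by (rule power_less_imp_less_exp[rotated]) simp
  define \<tau> where "\<tau> = initial_segment (tail k X) (N - k)"
  have \<tau>: "string_of_code n @ \<tau> = initial_segment X N"
    using \<open>k + n < N\<close> initial_segment_add[of X k "N - k"] by (simp add: n_def \<tau>_def)
  have len: "n < length \<tau>" using \<open>k + n < N\<close> by (simp add: \<tau>_def)
  have "d (string_of_code n @ take n \<tau>) \<le> 2 ^ (k + n)"
    using martingale_le[OF d, of "string_of_code n @ take n \<tau>"] len
    by (simp add: n_def)
  then have "M * K < d (string_of_code n @ \<tau>) - d (string_of_code n @ take n \<tau>)"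
  proof -
    have "M * K \<le> \<bar>M\<bar> * K" using K by (intro mult_right_mono) auto
    from add_mono[OF this \<open>d (string_of_code n @ take n \<tau>) \<le> 2 ^ (k + n)\<close>]
    have "M * K + d (string_of_code n @ take n \<tau>) < d (string_of_code n @ \<tau>)"
      using N unfolding \<tau> by (elim le_less_trans) (simp add: add.commute)
    then show ?thesis by simp
  qed
  then have "M < (d (string_of_code n @ \<tau>) - d (string_of_code n @ take n \<tau>)) / K"
    using K by (simp add: pos_less_divide_eq)
  also have "\<dots> \<le> bet_on_all_tails d \<tau>"
    unfolding K_def divide_inverse by (rule bet_on_all_tails_ge[OF d len])
  finally show "\<exists>n. M < bet_on_all_tails d (initial_segment (tail k X) n)" unfolding \<tau>_def by blast
qed

text \<open>
  The threshold \<open>q = 2\<close> is arbitrary: the martingale is unbounded on every tail.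
\<close>

lemma winning_cover_of_tails:
  assumes "\<not> computably_random X"
  shows "\<exists>\<U>. winning_open_set \<U> \<and> (\<forall>k. tail k X \<in> \<U>)"
proof -
  obtain d where d: "martingale d" "computable_real_valued d" "succeeds_on d X"
    using assms unfolding computably_random_def by blast
  obtain Q where Q: "computable_rat_valued Q" "martingale (\<lambda>\<sigma>. of_rat (Q \<sigma>))" "Q [] = 1"
    "succeeds_on (\<lambda>\<sigma>. of_rat (Q \<sigma>)) X"
    using rational_martingale[OF d(1,2)] d(3) by metis
  define G where "G = bet_on_all_tails (\<lambda>\<sigma>. of_rat (Q \<sigma>) :: real)"
  define U where "U = minimal_strings (\<lambda>\<sigma>. G \<sigma> \<ge> of_rat 2)"
  have "martingale G" unfolding G_def using Q by (intro martingale_bet_on_all_tails) auto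
  moreover have "exactly_computable G"
    unfolding exactly_computable_iff
  proof (intro exI conjI)
    show "computable_rat_valued (bet_on_all_tails Q)"
      unfolding computable_rat_valued_def bet_on_all_tails_def
      by (intro computable_intros recursive_rat_fn_apply[OF Q(1)]) auto
    show "G = (\<lambda>\<sigma>. of_rat (bet_on_all_tails Q \<sigma>))"
      unfolding G_def bet_on_all_tails_def
      by (rule ext) (simp add: of_rat_add of_rat_sum of_rat_mult of_rat_diff of_rat_inverse of_rat_power
        of_rat_divide)
  qed
  moreover have "normed G" by (simp add: normed_def G_def bet_on_all_tails_def)
  ultimately have "winning_set U"
    unfolding winning_set_def U_def by (intro exI[of _ G] exI[of _ 2]) auto
  then have "winning_open_set (open_of U)" unfolding winning_open_set_def by blast
  moreover have "tail k X \<in> open_of U" for k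
  proof -
    have "succeeds_on G (tail k X)" unfolding G_def using Q by (intro bet_on_all_tails_succeeds) auto
    then obtain n where "2 < G (initial_segment (tail k X) n)" unfolding succeeds_on_iff by blast
    then show ?thesis unfolding U_def by (intro mem_open_of_minimal_strings[of _ _ n]) auto
  qed
  ultimately show ?thesis by blast
qed

section \<open>Cutting a sequence into blocks\<close>

text \<open>
  The position of the next cut determines the next block.  As no block is empty, the cuts
  tend to infinity.
\<close>

lemma omega_power_of_cover:
  assumes U: "\<And>k. tail k X \<in> open_of U" "[] \<notin> U"
  shows "X \<in> omega_power U"
proof -
  have "\<forall>k. \<exists>\<sigma>. \<sigma> \<in> U \<and> tail k X \<in> cylinder \<sigma>" using U(1) unfolding open_of_def by blast
  then obtain w where w: "\<And>k. w k \<in> U" "\<And>k. tail k X \<in> cylinder (w k)" by metis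
  define pos where "pos = rec_nat 0 (\<lambda>_ k. k + length (w k))"
  have pos: "pos 0 = 0" "pos (Suc i) = pos i + length (w (pos i))" for i by (simp_all add: pos_def)
  define s where "s i = w (pos i)" for i
  have len: "length (concat (map s [0..<n])) = pos n" for n
    by (induction n) (simp_all add: pos s_def)
  have "X \<in> cylinder (concat (map s [0..<n]))" for n
  proof (induction n)
    case 0
    show ?case by (simp add: cylinder_def initial_segment_def)
  next
    case (Suc n)
    then show ?case using w(2)[of "pos n"] by (simp add: cylinder_append len s_def[of n])
  qed
  moreover have "n \<le> pos n" for n
  proof (induction n)
    case (Suc n)
    have "w (pos n) \<noteq> []" using w(1)[of "pos n"] U(2) by auto
    then have "0 < length (w (pos n))" by simp
    with Suc show ?case unfolding pos(2) by linarith
  qed simp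
  ultimately show ?thesis
    unfolding omega_power_def is_infinite_concat_def using w(1) len
    by (intro CollectI exI[of _ s]) (auto simp: s_def)
qed

section \<open>Restarting a martingale after each win\<close>

text \<open>
  The greedy parse of \<open>\<tau>\<close> into blocks that end as soon as \<open>P\<close> holds: this is the unfinished block after \<open>m\<close>
  bits.  The one-letter string \<open>drop i (take (Suc i) \<tau>)\<close> stands for the bit \<open>\<tau> ! i\<close>, in a
  form to which the closure rules for strings apply.
\<close>

definition block_at :: "(string2 \<Rightarrow> bool) \<Rightarrow> string2 \<Rightarrow> nat \<Rightarrow> string2" where
  "block_at P \<tau> m = rec_nat []
     (\<lambda>i \<rho>. if P (\<rho> @ drop i (take (Suc i) \<tau>)) then [] else \<rho> @ drop i (take (Suc i) \<tau>)) m"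

abbreviation current_block :: "(string2 \<Rightarrow> bool) \<Rightarrow> string2 \<Rightarrow> string2" where
  "current_block P \<tau> \<equiv> block_at P \<tau> (length \<tau>)"

text \<open>
  The product of the values of \<open>d\<close> over the finished blocks, that is, the capital with which the
  current block was started.  It ranges over a field because the same definition is
  used for the rational values, which are computed, and for the real ones.
\<close>

definition banked :: "(string2 \<Rightarrow> bool) \<Rightarrow> (string2 \<Rightarrow> 'a::field) \<Rightarrow> string2 \<Rightarrow> 'a" where
  "banked P d \<tau> = (\<Prod>i<length \<tau>. if P (block_at P \<tau> i @ drop i (take (Suc i) \<tau>))
     then d (block_at P \<tau> i @ drop i (take (Suc i) \<tau>)) else 1)"

definition replay :: "(string2 \<Rightarrow> bool) \<Rightarrow> (string2 \<Rightarrow> 'a::field) \<Rightarrow> string2 \<Rightarrow> 'a" where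
  "replay P d \<tau> = banked P d \<tau> * d (current_block P \<tau>)"

lemma block_at_append: "m \<le> length \<tau> \<Longrightarrow> block_at P (\<tau> @ \<upsilon>) m = block_at P \<tau> m"
  unfolding block_at_def by (induction m) auto

lemma current_block_snoc:
  "current_block P (\<tau> @ [b]) =
     (if P (current_block P \<tau> @ [b]) then [] else current_block P \<tau> @ [b])"
proof -
  have "current_block P (\<tau> @ [b]) = (if P (block_at P (\<tau> @ [b]) (length \<tau>) @ [b]) then []
      else block_at P (\<tau> @ [b]) (length \<tau>) @ [b])"
    by (simp add: block_at_def)
  then show ?thesis by (simp add: block_at_append)
qed

lemma banked_snoc:
  "banked P d (\<tau> @ [b]) = banked P d \<tau> *
     (if P (current_block P \<tau> @ [b]) then d (current_block P \<tau> @ [b]) else 1)"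
  unfolding banked_def by (simp add: block_at_append cong: if_cong)

text \<open>
  At the end of a block the factor \<open>d\<close> of the block moves into the bank and the current block becomes empty; because
  \<open>d\<close> is normed this leaves the capital unchanged, so the capital moves like \<open>d\<close> on the current block.
\<close>

lemma replay_snoc:
  assumes "d [] = 1"
  shows "replay P d (\<tau> @ [b]) = banked P d \<tau> * d (current_block P \<tau> @ [b])"
  unfolding replay_def current_block_snoc banked_snoc using assms by simp

lemma martingale_replay:
  assumes d: "martingale d" "d [] = 1"
  shows "martingale (replay P d)"
  unfolding martingale_def
proof (intro conjI allI)
  fix \<tau>
  show "0 \<le> replay P d \<tau>"
    unfolding replay_def banked_def using martingale_nonneg[OF d(1)]
    by (intro mult_nonneg_nonneg prod_nonneg) auto
  show "replay P d \<tau> = (replay P d (\<tau> @ [False]) + replay P d (\<tau> @ [True])) / 2"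
    unfolding replay_snoc[where d = d, OF d(2)] unfolding replay_def
    by (subst martingale_avg[OF d(1), of "current_block P \<tau>"]) (simp add: distrib_left)
qed

lemma computable_block_at:
  assumes Q: "computable_rat_valued Q" and s: "computable_string k s" and m: "computable k m"
  shows "computable_string k (\<lambda>xs. block_at (\<lambda>\<sigma>. q \<le> Q \<sigma>) (s xs) (m xs))"
  unfolding block_at_def by (intro computable_intros recursive_rat_fn_apply[OF Q] computable_string_tl s m) auto

lemma computable_replay:
  assumes Q: "computable_rat_valued Q" "\<And>\<sigma>. 0 \<le> Q \<sigma>"
  shows "computable_rat_valued (replay (\<lambda>\<sigma>. q \<le> Q \<sigma>) Q)"
  unfolding computable_rat_valued_def replay_def banked_def
  by (intro computable_intros recursive_rat_fn_prod recursive_rat_fn_apply[OF Q(1)]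
      computable_block_at[OF Q(1)]) (auto simp: Q(2))

text \<open>
  No proper prefix of a minimal string satisfies \<open>P\<close>, so the greedy parse does not stop before the end of \<open>\<sigma>\<close>.
\<close>

lemma follow_block:
  assumes \<sigma>: "\<sigma> \<in> minimal_strings P" and P: "\<not> P []" and \<tau>: "current_block P \<tau> = []"
  shows "current_block P (\<tau> @ \<sigma>) = []" "banked P d (\<tau> @ \<sigma>) = banked P d \<tau> * d \<sigma>"
proof -
  have before: "current_block P (\<tau> @ \<upsilon>) = \<upsilon> \<and> banked P d (\<tau> @ \<upsilon>) = banked P d \<tau>"
    if "strict_prefix \<upsilon> \<sigma>" for \<upsilon>
    using that
  proof (induction \<upsilon> rule: rev_induct)
    case (snoc b \<upsilon>)
    have "strict_prefix \<upsilon> (\<upsilon> @ [b])" by (simp add: strict_prefix_def)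
    then have "strict_prefix \<upsilon> \<sigma>" using snoc.prems by (rule prefix_order.less_trans)
    moreover have "\<not> P (\<upsilon> @ [b])" using \<sigma> snoc.prems unfolding minimal_strings_def by blast
    ultimately show ?case
      using snoc.IH current_block_snoc[of P "\<tau> @ \<upsilon>" b] banked_snoc[of P d "\<tau> @ \<upsilon>" b] by simp
  qed (simp add: \<tau>)
  have "P \<sigma>" using \<sigma> by (simp add: minimal_strings_def)
  with P obtain \<upsilon> b where eq: "\<sigma> = \<upsilon> @ [b]" by (cases \<sigma> rule: rev_cases) auto
  then have "strict_prefix \<upsilon> \<sigma>" by (simp add: strict_prefix_def)
  from before[OF this] show "current_block P (\<tau> @ \<sigma>) = []"
    "banked P d (\<tau> @ \<sigma>) = banked P d \<tau> * d \<sigma>"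
    using \<open>P \<sigma>\<close> current_block_snoc[of P "\<tau> @ \<upsilon>" b] banked_snoc[of P d "\<tau> @ \<upsilon>" b]
    by (simp_all add: eq)
qed

lemma replay_succeeds:
  fixes d :: "string2 \<Rightarrow> real"
  assumes d: "d [] = 1" and P: "P = (\<lambda>\<sigma>. q \<le> d \<sigma>)" and q: "1 < q"
    and X: "X \<in> omega_power (minimal_strings P)"
  shows "succeeds_on (replay P d) X"
proof -
  obtain s where s: "\<And>i. s i \<in> minimal_strings P" "\<And>n. X \<in> cylinder (concat (map s [0..<n]))"
    using X unfolding omega_power_def is_infinite_concat_def by blast
  have "\<not> P []" using d q by (simp add: P)
  have "current_block P (concat (map s [0..<n])) = [] \<and> q ^ n \<le> banked P d (concat (map s [0..<n]))" for n
  proof (induction n)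
    case 0
    show ?case by (simp add: block_at_def banked_def)
  next
    case (Suc n)
    have "q \<le> d (s n)" using s(1)[of n] by (simp add: minimal_strings_def P)
    then have "q ^ n * q \<le> banked P d (concat (map s [0..<n])) * d (s n)"
      using Suc q by (intro mult_mono) (auto intro: order_trans[of 0 "q ^ n"])
    then show ?case
      using Suc follow_block(1)[OF s(1)[of n] \<open>\<not> P []\<close>, of "concat (map s [0..<n])"]
        follow_block(2)[OF s(1)[of n] \<open>\<not> P []\<close>, of "concat (map s [0..<n])" d]
      by (simp add: mult.commute)
  qed
  then have "q ^ n \<le> replay P d (initial_segment X (length (concat (map s [0..<n]))))" for n
    using s(2)[of n] d by (simp add: cylinder_def replay_def)
  then show ?thesis
    unfolding succeeds_on_iff using real_arch_pow[OF q] by (meson less_le_trans)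
qed

lemma not_random_of_omega_power:
  assumes "winning_set U" "X \<in> omega_power U"
  shows "\<not> computably_random X"
proof -
  obtain d and q :: rat where d: "martingale d" "exactly_computable d" "normed d" "q > 1"
    and U: "U = minimal_strings (\<lambda>\<sigma>. d \<sigma> \<ge> of_rat q)"
    using assms(1) unfolding winning_set_def by blast
  obtain Q where Q: "computable_rat_valued Q" "d = (\<lambda>\<sigma>. of_rat (Q \<sigma>))"
    using d(2) unfolding exactly_computable_iff by blast
  define P where "P \<sigma> \<longleftrightarrow> q \<le> Q \<sigma>" for \<sigma>
  have P: "P = (\<lambda>\<sigma>. of_rat q \<le> d \<sigma>)" by (simp add: P_def Q(2) of_rat_less_eq fun_eq_iff)
  have d1: "d [] = 1" using d(3) by (simp add: normed_def)
  have "0 \<le> Q \<sigma>" for \<sigma> using martingale_nonneg[OF d(1), of \<sigma>] by (simp add: Q(2))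
  then have "computable_rat_valued (replay P Q)"
    using Q(1) unfolding P_def by (intro computable_replay)
  moreover have "replay P d = (\<lambda>\<sigma>. of_rat (replay P Q \<sigma>))"
    by (rule ext) (simp add: replay_def banked_def Q(2) of_rat_mult of_rat_prod if_distrib[of of_rat] cong: if_cong)
  ultimately have "computable_real_valued (replay P d)"
    using computable_real_valued_of_rat by metis
  moreover have "martingale (replay P d)" using d(1) d1 by (rule martingale_replay)
  moreover have "succeeds_on (replay P d) X"
    using d1 P _ assms(2)[unfolded U, folded P] by (rule replay_succeeds) (use d(4) in simp)
  ultimately show ?thesis unfolding computably_random_def by blast
qed

section \<open>The equivalence\<close>

theorem theorem2p3:
  fixes X :: cantor
  shows "(\<not> computably_random X \<longleftrightarrow>
            (\<exists>\<U>. winning_open_set \<U> \<and> (\<forall>k. tail k X \<in> \<U>))) \<and>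
         ((\<exists>\<U>. winning_open_set \<U> \<and> (\<forall>k. tail k X \<in> \<U>)) \<longleftrightarrow>
            (\<exists>U. winning_set U \<and> X \<in> omega_power U))"
proof -
  let ?tails_covered = "\<exists>\<U>. winning_open_set \<U> \<and> (\<forall>k. tail k X \<in> \<U>)"
  let ?concatenation = "\<exists>U. winning_set U \<and> X \<in> omega_power U"
  have "?tails_covered" if "\<not> computably_random X"
    using that by (rule winning_cover_of_tails)
  moreover have "?concatenation" if "?tails_covered"
  proof -
    obtain \<U> where \<U>: "winning_open_set \<U>" "\<And>k. tail k X \<in> \<U>" using \<open>?tails_covered\<close> by auto
    obtain U where U: "winning_set U" "\<U> = open_of U"
      using \<U>(1) unfolding winning_open_set_def by auto
    have "[] \<notin> U"
      using U(1) by (auto simp: winning_set_def minimal_strings_def normed_def)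
    then have "X \<in> omega_power U"
      using \<U>(2) U(2) by (intro omega_power_of_cover) auto
    with U(1) show ?thesis by auto
  qed
  moreover have "\<not> computably_random X" if "?concatenation"
    using that not_random_of_omega_power by auto
  ultimately show ?thesis by argo
qed

end
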